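(* Let $q>0$, $q\ne 1$, $h>0$, $N_{\mathrm{lf}}\in\mathbb N$. Assume that $U$ is continuous and finite on the open set $\mathcal X\subseteq\mathbb R^d$, so that $\pi(x)\propto\exp[-U(x)]$ is strictly positive on $\mathcal X$, and that $U(x)=+\infty$ outside $\mathcal X$. Assume also that the momentum density $\nu(p)\propto\exp[-K(p)]$ is strictly positive on $\mathbb R^d$. Suppose that for every $x\in\mathcal X$ the measure $$Q_x(A):=\int_{\{p:\,G_x(p)\in A\}}\nu(p)\,dp,\qquad A\in\mathcal B(\mathcal X),$$ is equivalent to (i.e. mutually absolutely continuous with) Lebesgue measure restricted to $\mathcal X$, where $G_x(p)=\operatorname{pr}_x(\Psi_{q,h,N_{\mathrm{lf}}}(x,p))$ is the position component of the $q$-Hamiltonian proposal. Then the position chain generated by the Metropolis-adjusted $q$-Hamiltonian sampler is Lebesgue-irreducible on $\mathcal X$.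
   Context: Setting: $\pi(x)\propto\exp[-U(x)]$ is a probability density on $\mathcal X$ with respect to Lebesgue measure; the kinetic energy $K:\mathbb R^d\to\mathbb R$ is even, $K(-p)=K(p)$, with $\nu(p)\propto\exp[-K(p)]$ a probability density; $H(x,p)=U(x)+K(p)$. Jackson derivatives (componentwise): $(\mathcal D_xU)_i(x)=\dfrac{U(x_1,\dots,q^2x_i,\dots,x_d)-U(x)}{(q^2-1)x_i}$, $(\mathcal D_pK)_i(p)=\dfrac{K(p_1,\dots,q^2p_i,\dots,p_d)-K(p)}{(q^2-1)p_i}$; where a denominator vanishes, the corresponding limiting value is used. Set $G_q(x)=q^{1/2}\mathcal D_xU(x)$ and $v_q(p)=q^{-1/2}\mathcal D_pK(p)$, understood as well-defined (Borel) maps $\mathbb R^d\to\mathbb R^d$. (The function $G_q$ is the force map and is distinct from the projected proposal $G_x$.) Proposal: $A_h(x,p)=(x,\,p-hG_q(x))$, $B_h(x,p)=(x+hv_q(p),\,p)$, $\Phi_{q,h}=A_{h/2}\circ B_h\circ A_{h/2}$, $\Phi_{q,h,N_{\mathrm{lf}}}=(\Phi_{q,h})^{N_{\mathrm{lf}}}$, $T(x,p)=(x,-p)$, $\Psi_{q,h,N_{\mathrm{lf}}}=T\circ\Phi_{q,h,N_{\mathrm{lf}}}$; $\operatorname{pr}_x(x,p)=x$. Metropolis-adjusted $q$-Hamiltonian sampler (one step from $x_{\mathrm{curr}}\in\mathcal X$): sample $p\sim\nu$; set $z=(x_{\mathrm{curr}},p)$ and $z^*=\Psi_{q,h,N_{\mathrm{lf}}}(z)$;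 with $\alpha(z,z^* )=\min\{1,\exp[-H(z^* )+H(z)]\}$ (and $e^{-\infty}=0$), draw $u\sim\mathrm{Uniform}(0,1)$; if $u<\alpha(z,z^* )$, set $x_{\mathrm{next}}$ equal to the position component of $z^*$; otherwise set $x_{\mathrm{next}}=x_{\mathrm{curr}}$. Let $P(x,\cdot)$ be the resulting position transition kernel on $\mathcal X$. Lebesgue-irreducible on $\mathcal X$: for every $x\in\mathcal X$ and every Borel $A\subset\mathcal X$ of positive Lebesgue measure, there is $n\ge1$ with $P^n(x,A)>0$. *)

theory Defs
  imports "HOL-Probability.Probability"
begin

definition exp_ereal :: "ereal \<Rightarrow> ennreal" where
  "exp_ereal y = (case y of ereal r \<Rightarrow> ennreal (exp r) | PInfty \<Rightarrow> \<infinity> | MInfty \<Rightarrow> 0)"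

text \<open>Normalised density proportional to \<open>exp (- E)\<close>. If the normalising constant is 0 or infinite,
  the integral of this function is 0, so asking for a probability space excludes these cases.\<close>

definition gibbs :: "('a::euclidean_space \<Rightarrow> ereal) \<Rightarrow> 'a \<Rightarrow> ennreal" where
  "gibbs E x = exp_ereal (- E x) / (\<integral>\<^sup>+ y. exp_ereal (- E y) \<partial>lborel)"

definition gibbs_measure :: "('a::euclidean_space \<Rightarrow> ereal) \<Rightarrow> 'a measure" where
  "gibbs_measure E = density lborel (gibbs E)"

definition set_coord :: "real^'n \<Rightarrow> 'n \<Rightarrow> real \<Rightarrow> real^'n" where
  "set_coord x i t = (\<chi> j. if j = i then t else x $ j)"

definition jackson_quotient :: "real \<Rightarrow> (real^'n \<Rightarrow> ereal) \<Rightarrow> 'n \<Rightarrow> real^'n \<Rightarrow> ereal" where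
  "jackson_quotient q f i x =
     (f (set_coord x i (q^2 * x $ i)) - f x) / ereal ((q^2 - 1) * x $ i)"

text \<open>A real \<open>L\<close> can equal the quotient only if both values of \<open>f\<close> in the numerator are finite,
  because \<open>\<infinity> - \<infinity> = \<infinity>\<close> in \<open>ereal\<close>. Where the denominator vanishes, the limit is taken along the
  \<open>i\<close>-th coordinate.\<close>

definition has_jackson_deriv ::
    "real \<Rightarrow> (real^'n \<Rightarrow> ereal) \<Rightarrow> 'n \<Rightarrow> real^'n \<Rightarrow> real \<Rightarrow> bool" where
  "has_jackson_deriv q f i x L \<longleftrightarrow>
     (if x $ i \<noteq> 0 then jackson_quotient q f i x = ereal L
      else ((\<lambda>t. jackson_quotient q f i (set_coord x i t)) \<longlongrightarrow> ereal L) (at 0))"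

text \<open>\<open>D\<close> is a Borel version of the Jackson gradient of \<open>f\<close>: it is the Jackson gradient wherever that
  has a real value, and it must have one wherever the energies involved are finite. Where an
  infinite energy leaves the formula without a real value, \<open>D\<close> is only required to be Borel. For a
  real-valued \<open>f\<close> this determines \<open>D\<close> everywhere.\<close>

definition jackson_gradient ::
    "real \<Rightarrow> (real^'n \<Rightarrow> ereal) \<Rightarrow> (real^'n \<Rightarrow> real^'n) \<Rightarrow> bool" where
  "jackson_gradient q f D \<longleftrightarrow>
     D \<in> borel_measurable borel \<and>
     (\<forall>x i L. has_jackson_deriv q f i x L \<longrightarrow> D x $ i = L) \<and>
     (\<forall>x i. \<bar>f x\<bar> \<noteq> \<infinity> \<and> \<bar>f (set_coord x i (q^2 * x $ i))\<bar> \<noteq> \<infinity> \<longrightarrow>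
            (\<exists>L. has_jackson_deriv q f i x L))"

type_synonym 'n phase = "(real^'n) \<times> (real^'n)"

definition force :: "real \<Rightarrow> (real^'n \<Rightarrow> real^'n) \<Rightarrow> real^'n \<Rightarrow> real^'n" where
  "force q DU x = (q powr (1/2)) *\<^sub>R DU x"

definition velocity :: "real \<Rightarrow> (real^'n \<Rightarrow> real^'n) \<Rightarrow> real^'n \<Rightarrow> real^'n" where
  "velocity q DK p = (q powr (- (1/2))) *\<^sub>R DK p"

definition kick :: "(real^'n \<Rightarrow> real^'n) \<Rightarrow> real \<Rightarrow> 'n phase \<Rightarrow> 'n phase" where
  "kick G h = (\<lambda>(x, p). (x, p - h *\<^sub>R G x))"

definition drift :: "(real^'n \<Rightarrow> real^'n) \<Rightarrow> real \<Rightarrow> 'n phase \<Rightarrow> 'n phase" where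
  "drift v h = (\<lambda>(x, p). (x + h *\<^sub>R v p, p))"

definition leapfrog ::
    "real \<Rightarrow> (real^'n \<Rightarrow> real^'n) \<Rightarrow> (real^'n \<Rightarrow> real^'n) \<Rightarrow> real \<Rightarrow> 'n phase \<Rightarrow> 'n phase" where
  "leapfrog q DU DK h =
     kick (force q DU) (h/2) \<circ> drift (velocity q DK) h \<circ> kick (force q DU) (h/2)"

definition momentum_flip :: "('n::finite) phase \<Rightarrow> 'n phase" where
  "momentum_flip = (\<lambda>(x, p). (x, - p))"

definition proposal ::
    "real \<Rightarrow> (real^'n \<Rightarrow> real^'n) \<Rightarrow> (real^'n \<Rightarrow> real^'n) \<Rightarrow> real \<Rightarrow> nat \<Rightarrow> 'n phase \<Rightarrow> 'n phase" where
  "proposal q DU DK h N = momentum_flip \<circ> (leapfrog q DU DK h ^^ N)"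

definition hamiltonian :: "(real^'n \<Rightarrow> ereal) \<Rightarrow> (real^'n \<Rightarrow> real) \<Rightarrow> 'n phase \<Rightarrow> ereal" where
  "hamiltonian U K = (\<lambda>(x, p). U x + ereal (K p))"

definition accept_prob ::
    "(real^'n \<Rightarrow> ereal) \<Rightarrow> (real^'n \<Rightarrow> real) \<Rightarrow> 'n phase \<Rightarrow> 'n phase \<Rightarrow> ennreal" where
  "accept_prob U K z z' = min 1 (exp_ereal (- hamiltonian U K z' + hamiltonian U K z))"

text \<open>Law of the next position: the image of \<open>\<nu> \<otimes> Uniform(0,1)\<close> under the accept/reject rule.
  From \<open>x \<in> X\<close> the next position is always in \<open>X\<close>, since \<open>accept_prob\<close> is 0 for a proposal outside \<open>X\<close>,
  where \<open>U = \<infinity>\<close>.\<close>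

definition mh_kernel ::
    "(real^'n) set \<Rightarrow> (real^'n \<Rightarrow> ereal) \<Rightarrow> (real^'n \<Rightarrow> real) \<Rightarrow> ('n phase \<Rightarrow> 'n phase) \<Rightarrow>
     real^'n \<Rightarrow> (real^'n) measure" where
  "mh_kernel X U K \<Psi> x =
     distr (gibbs_measure (\<lambda>p. ereal (K p)) \<Otimes>\<^sub>M uniform_measure lborel {0<..<1::real})
       (restrict_space borel X)
       (\<lambda>(p, u). if ennreal u < accept_prob U K (x, p) (\<Psi> (x, p)) then fst (\<Psi> (x, p)) else x)"

primrec kernel_power :: "('a \<Rightarrow> 'a measure) \<Rightarrow> nat \<Rightarrow> 'a \<Rightarrow> 'a set \<Rightarrow> ennreal" where
  "kernel_power P 0 x A = indicator A x"
| "kernel_power P (Suc n) x A = (\<integral>\<^sup>+ y. kernel_power P n y A \<partial>P x)"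

definition lebesgue_irreducible ::
    "'a::euclidean_space set \<Rightarrow> ('a \<Rightarrow> 'a measure) \<Rightarrow> bool" where
  "lebesgue_irreducible X P \<longleftrightarrow>
     (\<forall>x\<in>X. \<forall>A\<in>sets borel. A \<subseteq> X \<and> emeasure lborel A > 0 \<longrightarrow>
        (\<exists>n\<ge>1. kernel_power P n x A > 0))"

text \<open>The proposal may leave \<open>X\<close>, hence the image measure is formed on the whole space and then
  restricted; the result is in general a sub-probability measure on \<open>X\<close>.\<close>

definition proposal_measure ::
    "(real^'n) set \<Rightarrow> (real^'n \<Rightarrow> real) \<Rightarrow> ('n phase \<Rightarrow> 'n phase) \<Rightarrow> real^'n \<Rightarrow> (real^'n) measure" where
  "proposal_measure X K \<Psi> x =
     restrict_space (distr (gibbs_measure (\<lambda>p. ereal (K p))) borel (\<lambda>p. fst (\<Psi> (x, p)))) X"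

definition equivalent_measures :: "'a measure \<Rightarrow> 'a measure \<Rightarrow> bool" where
  "equivalent_measures M N \<longleftrightarrow>
     sets M = sets N \<and> absolutely_continuous M N \<and> absolutely_continuous N M"

end

theory Submission
  imports Defs
begin

text \<open>
  A single step already charges every target set. Fix \<open>x \<in> X\<close> and a Borel set \<open>A \<subseteq> X\<close> of positive
  Lebesgue measure. By equivalence of \<open>Q\<^sub>x\<close> with Lebesgue measure, the set \<open>S\<close> of momenta whose
  proposal lands in \<open>A\<close> has positive \<open>\<nu>\<close>-probability. On \<open>S\<close> both energies are finite, since \<open>U\<close> is
  finite on \<open>X\<close> and \<open>K\<close> is real-valued, so the acceptance probability is strictly positive
  (\<open>accept_prob_pos\<close>). Integrating a strictly positive function over a set of positive measure gives
  a positive number (\<open>accepted_proposals_pos\<close>); this number bounds \<open>P(x, A)\<close> from below, as an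
  accepted proposal in \<open>A\<close> is a next position in \<open>A\<close>.

  The remaining work is measurability. The law of the next position is an image measure on \<open>X\<close>, so
  its values can be computed only once the accept/reject map is known to be Borel and to stay in
  \<open>X\<close>. The latter holds because a proposal outside \<open>X\<close> has infinite energy and acceptance
  probability 0.
\<close>

section \<open>Measurability of the proposal and of the acceptance probability\<close>

lemma borel_measurable_exp_ereal [measurable]: "exp_ereal \<in> borel_measurable borel"
proof -
  have eq: "exp_ereal = (\<lambda>y. if y = \<infinity> then \<infinity> else if y = -\<infinity> then 0
                         else ennreal (exp (real_of_ereal y)))"
  proof
    fix y show "exp_ereal y = (if y = \<infinity> then \<infinity> else if y = -\<infinity> then 0
                         else ennreal (exp (real_of_ereal y)))"
      by (cases y) (auto simp: exp_ereal_def)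
  qed
  show ?thesis unfolding eq by measurable
qed

lemma borel_measurable_continuous_on_open_const_outside:
  fixes f :: "'a::topological_space \<Rightarrow> 'b::topological_space"
  assumes "open X" "continuous_on X f" "\<And>x. x \<notin> X \<Longrightarrow> f x = c"
  shows "f \<in> borel_measurable borel"
proof -
  have "(\<lambda>x. if x \<in> X then f x else c) \<in> borel_measurable borel"
    using assms
    by (subst measurable_If_restrict_space_iff)
       (auto intro: borel_measurable_continuous_on_restrict)
  also have "(\<lambda>x. if x \<in> X then f x else c) = f"
    using assms(3) by auto
  finally show ?thesis .
qed

lemma borel_measurable_leapfrog:
  fixes DU DK :: "real^'n \<Rightarrow> real^'n"
  assumes [measurable]: "DU \<in> borel_measurable borel" "DK \<in> borel_measurable borel"
  shows "leapfrog q DU DK h \<in> borel_measurable borel"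
  unfolding leapfrog_def kick_def drift_def force_def velocity_def comp_def borel_prod [symmetric]
  by measurable

lemma borel_measurable_proposal:
  fixes DU DK :: "real^'n \<Rightarrow> real^'n"
  assumes "DU \<in> borel_measurable borel" "DK \<in> borel_measurable borel"
  shows "proposal q DU DK h N \<in> borel_measurable borel"
proof -
  have "leapfrog q DU DK h ^^ N \<in> borel_measurable borel"
    using borel_measurable_leapfrog [OF assms]
    by (induction N) (auto intro: measurable_comp)
  moreover have "(momentum_flip :: 'n phase \<Rightarrow> _) \<in> borel_measurable borel"
    unfolding momentum_flip_def borel_prod [symmetric] by measurable
  ultimately show ?thesis
    unfolding proposal_def by (rule measurable_comp)
qed

lemma borel_measurable_hamiltonian:
  fixes U :: "real^'n \<Rightarrow> ereal"
  assumes [measurable]: "U \<in> borel_measurable borel" "K \<in> borel_measurable borel"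
  shows "hamiltonian U K \<in> borel_measurable borel"
  unfolding hamiltonian_def borel_prod [symmetric] by measurable

section \<open>Accepting a proposal\<close>

lemma accept_prob_pos:
  assumes "\<bar>U (fst z)\<bar> \<noteq> \<infinity>" "\<bar>U (fst z')\<bar> \<noteq> \<infinity>"
  shows "accept_prob U K z z' > 0"
  using assms
  by (cases "U (fst z)"; cases "U (fst z')"; cases z; cases z')
     (auto simp: accept_prob_def hamiltonian_def exp_ereal_def)

lemma accept_prob_eq_0:
  assumes "\<bar>U (fst z)\<bar> \<noteq> \<infinity>" "U (fst z') = \<infinity>"
  shows "accept_prob U K z z' = 0"
  using assms
  by (cases "U (fst z)"; cases z; cases z')
     (auto simp: accept_prob_def hamiltonian_def exp_ereal_def)

text \<open>Truncating \<open>a\<close> at 1 makes it a real number \<open>c\<close>, and \<open>{0<..<c}\<close> is then an interval of positive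
  length inside the event.\<close>

lemma emeasure_uniform_below_pos:
  fixes a :: ennreal
  assumes "a > 0"
  shows "emeasure (uniform_measure lborel {0<..<1::real}) {u. ennreal u < a} > 0"
proof -
  obtain c :: real where c: "0 < c" "c \<le> 1" "ennreal c \<le> a"
  proof (cases "a \<ge> 1")
    case True
    then show ?thesis using that [of 1] by simp
  next
    case False
    then have "a < top" by (auto simp: not_le intro: less_trans)
    then obtain r where "a = ennreal r" "r \<ge> 0"
      by (cases a) auto
    then show ?thesis using that [of r] False assms by (auto simp: ennreal_ge_1)
  qed
  have "{0<..<c} \<subseteq> {0<..<1} \<inter> {u. ennreal u < a}"
    using c by (auto intro: less_le_trans [OF ennreal_lessI])
  then have "emeasure lborel {0<..<c} \<le> emeasure lborel ({0<..<1} \<inter> {u. ennreal u < a})"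
    by (intro emeasure_mono) auto
  moreover have "emeasure lborel {0<..<c} > 0" using c by simp
  ultimately show ?thesis
    by (subst emeasure_uniform_measure) (auto simp: divide_ennreal_def)
qed

text \<open>By Tonelli, the measure of the event is the integral over \<open>p \<in> S\<close> of the probability
  \<open>min 1 (a p)\<close> that a uniform variable lies below \<open>a p\<close>; it vanishes only if this probability is
  0 almost everywhere on \<open>S\<close>. For the accept/reject step, \<open>S\<close> is the set of momenta that propose a
  point of the target set.\<close>

lemma accepted_proposals_pos:
  assumes [measurable]: "S \<in> sets M" "a \<in> borel_measurable M"
    and a: "\<And>p. p \<in> S \<Longrightarrow> a p > 0"
    and S: "emeasure M S > 0"
  shows "emeasure (M \<Otimes>\<^sub>M uniform_measure lborel {0<..<1::real})
           {z \<in> space (M \<Otimes>\<^sub>M uniform_measure lborel {0<..<1::real}).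
              fst z \<in> S \<and> ennreal (snd z) < a (fst z)} > 0"
    (is "emeasure (M \<Otimes>\<^sub>M ?L) ?E > 0")
proof (rule ccontr)
  interpret L: prob_space ?L
    by (rule prob_space_uniform_measure) auto
  assume "\<not> emeasure (M \<Otimes>\<^sub>M ?L) ?E > 0"
  moreover have [measurable]: "?E \<in> sets (M \<Otimes>\<^sub>M ?L)"
    by measurable
  ultimately have "(\<integral>\<^sup>+ p. emeasure ?L (Pair p -` ?E) \<partial>M) = 0"
    by (simp add: L.emeasure_pair_measure_alt)
  then have "AE p in M. emeasure ?L (Pair p -` ?E) = 0"
    by (subst (asm) nn_integral_0_iff_AE) (auto intro: L.measurable_emeasure_Pair)
  moreover have "emeasure ?L (Pair p -` ?E) > 0" if "p \<in> S" for p
  proof -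
    have "Pair p -` ?E = {u. ennreal u < a p}"
      using that sets.sets_into_space [OF assms(1)] by (auto simp: space_pair_measure)
    then show ?thesis using emeasure_uniform_below_pos [OF a [OF that]] by simp
  qed
  ultimately have "AE p in M. p \<notin> S"
    by (metis (mono_tags, lifting) eventually_mono less_irrefl)
  then have "emeasure M S = 0"
    using AE_iff_measurable [of S M "\<lambda>p. p \<notin> S"] sets.sets_into_space [OF assms(1)] by auto
  then show False using S by simp
qed

section \<open>One-step irreducibility\<close>

theorem theorem4:
  fixes X :: "(real^'n) set"
    and U :: "real^'n \<Rightarrow> ereal"
    and K :: "real^'n \<Rightarrow> real"
    and DU DK :: "real^'n \<Rightarrow> real^'n"
    and q h :: real
    and N :: nat
  assumes q: "q > 0" "q \<noteq> 1"
    and h: "h > 0"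
    and X_open: "open X"
    and U_cont: "continuous_on X U"
    and U_finite: "\<forall>x\<in>X. \<bar>U x\<bar> \<noteq> \<infinity>"
    and U_outside: "\<forall>x. x \<notin> X \<longrightarrow> U x = \<infinity>"
    and target: "prob_space (gibbs_measure U)"
    and K_borel: "K \<in> borel_measurable borel"
    and K_even: "\<forall>p. K (- p) = K p"
    and momentum: "prob_space (gibbs_measure (\<lambda>p. ereal (K p)))"
    and momentum_pos: "\<forall>p. gibbs (\<lambda>p. ereal (K p)) p > 0"
    and DU: "jackson_gradient q U DU"
    and DK: "jackson_gradient q (\<lambda>p. ereal (K p)) DK"
    and Q_equiv: "\<forall>x\<in>X. equivalent_measures
        (proposal_measure X K (proposal q DU DK h N) x) (restrict_space lborel X)"
  shows "lebesgue_irreducible X (mh_kernel X U K (proposal q DU DK h N))"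
proof -
  define \<Psi> where "\<Psi> = proposal q DU DK h N"
  define \<nu> where "\<nu> = gibbs_measure (\<lambda>p. ereal (K p))"
  let ?L = "uniform_measure lborel {0<..<1::real}"
  have sets_\<nu> [measurable_cong]: "sets \<nu> = sets borel"
    and space_\<nu>: "space \<nu> = UNIV"
    by (auto simp: \<nu>_def gibbs_measure_def)
  have [measurable]: "U \<in> borel_measurable borel"
    using borel_measurable_continuous_on_open_const_outside X_open U_cont U_outside by blast
  note K_borel [measurable]
  have \<Psi>: "\<Psi> \<in> borel_measurable borel"
    using DU DK unfolding \<Psi>_def jackson_gradient_def by (intro borel_measurable_proposal) auto
  have [measurable]: "X \<in> sets borel" using X_open by simp
  have "\<exists>n\<ge>1. kernel_power (mh_kernel X U K \<Psi>) n x A > 0"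
    if x: "x \<in> X" and A [measurable]: "A \<in> sets borel" and AX: "A \<subseteq> X"
      and A_pos: "emeasure lborel A > 0" for x A
  proof -
    define a where "a = (\<lambda>p. accept_prob U K (x, p) (\<Psi> (x, p)))"
    define f where "f = (\<lambda>(p, u). if ennreal u < a p then fst (\<Psi> (x, p)) else x)"
    define S where "S = {p. fst (\<Psi> (x, p)) \<in> A}"
    have [measurable]: "(\<lambda>p. \<Psi> (x, p)) \<in> borel_measurable borel"
      by (rule measurable_compose [OF _ \<Psi>]) (simp add: borel_prod [symmetric])
    have [measurable]: "(\<lambda>p. fst (\<Psi> (x, p))) \<in> borel_measurable borel"
      by (rule measurable_compose [OF _ borel_measurable_continuous_onI
             [OF continuous_on_fst [OF continuous_on_id]]]) measurable
    have [measurable]: "(\<lambda>p. hamiltonian U K (x, p)) \<in> borel_measurable borel"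
      by (rule measurable_compose [OF _ borel_measurable_hamiltonian])
         (simp_all add: borel_prod [symmetric])
    have [measurable]: "(\<lambda>p. hamiltonian U K (\<Psi> (x, p))) \<in> borel_measurable borel"
      by (rule measurable_compose [OF _ borel_measurable_hamiltonian]) simp_all
    have a_meas [measurable]: "a \<in> borel_measurable borel"
      unfolding a_def accept_prob_def by measurable
    have S_meas [measurable]: "S \<in> sets borel"
      unfolding S_def by measurable

    have "A \<notin> null_sets (restrict_space lborel X)"
      using A_pos AX by (auto simp: null_sets_def emeasure_restrict_space)
    moreover have "sets (proposal_measure X K \<Psi> x) = sets (restrict_space borel X)"
      by (simp add: proposal_measure_def sets_restrict_space)
    then have A_sets: "A \<in> sets (proposal_measure X K \<Psi> x)"
      using AX by (auto simp: sets_restrict_space_iff)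
    ultimately have "emeasure (proposal_measure X K \<Psi> x) A \<noteq> 0"
      using Q_equiv x
      unfolding equivalent_measures_def absolutely_continuous_def \<Psi>_def [symmetric]
      by (meson null_setsI subsetD)
    moreover have "emeasure (proposal_measure X K \<Psi> x) A = emeasure \<nu> S"
      using AX
      by (simp add: proposal_measure_def \<nu>_def [symmetric] emeasure_restrict_space emeasure_distr
          S_def space_\<nu> vimage_def)
    ultimately have S_pos: "emeasure \<nu> S > 0"
      by (simp add: zero_less_iff_neq_zero)

    have a_pos: "a p > 0" if "p \<in> S" for p
    proof -
      have "fst (\<Psi> (x, p)) \<in> X" using that AX by (auto simp: S_def)
      then show ?thesis
        unfolding a_def using x U_finite by (intro accept_prob_pos) (metis fst_conv)+
    qed
    have f_in_X: "f z \<in> X" for z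
    proof (cases z)
      case (Pair p u)
      have "a p = 0" if "fst (\<Psi> (x, p)) \<notin> X"
        unfolding a_def using that x U_finite U_outside
        by (intro accept_prob_eq_0) (metis fst_conv)+
      then show ?thesis
        using x Pair by (cases "fst (\<Psi> (x, p)) \<in> X") (auto simp: f_def)
    qed
    have f_borel: "f \<in> borel_measurable (\<nu> \<Otimes>\<^sub>M ?L)"
      unfolding f_def by measurable
    then have f_meas: "f \<in> measurable (\<nu> \<Otimes>\<^sub>M ?L) (restrict_space borel X)"
      using f_in_X by (auto intro: measurable_restrict_space2)
    have A_X: "A \<in> sets (restrict_space borel X)"
      using AX by (auto simp: sets_restrict_space_iff)
    have kernel: "mh_kernel X U K \<Psi> x = distr (\<nu> \<Otimes>\<^sub>M ?L) (restrict_space borel X) f"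
      by (simp add: mh_kernel_def \<nu>_def f_def a_def)

    have "0 < emeasure (\<nu> \<Otimes>\<^sub>M ?L)
                {z \<in> space (\<nu> \<Otimes>\<^sub>M ?L). fst z \<in> S \<and> ennreal (snd z) < a (fst z)}"
      using a_pos S_pos by (intro accepted_proposals_pos) auto
    also have "\<dots> \<le> emeasure (\<nu> \<Otimes>\<^sub>M ?L) (f -` A \<inter> space (\<nu> \<Otimes>\<^sub>M ?L))"
      by (rule emeasure_mono [OF _ measurable_sets [OF f_borel A]]) (auto simp: f_def S_def)
    also have "\<dots> = emeasure (mh_kernel X U K \<Psi> x) A"
      using f_meas A_X by (simp add: kernel emeasure_distr)
    also have "\<dots> = kernel_power (mh_kernel X U K \<Psi>) 1 x A"
      using A_X by (simp add: kernel)
    finally show ?thesis by blast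
  qed
  then show ?thesis
    unfolding lebesgue_irreducible_def \<Psi>_def by blast
qed

end
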